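(* Let $\mathbf{X}$ be a quasi-Polish space. The following are equivalent: 1. $\mathbf{X}$ is Noetherian. 2. Every $\Delta^0_2$-cover of $\mathbf{X}$ has a finite subcover, i.e. every family of $\boldsymbol{\Delta}^0_2$-subsets of $\mathbf{X}$ whose union is $\mathbf{X}$ has a finite subfamily whose union is $\mathbf{X}$. 3. Every $\Sigma^0_2$-cover of $\mathbf{X}$ has a finite subcover, i.e. every family of $\boldsymbol{\Sigma}^0_2$-subsets of $\mathbf{X}$ whose union is $\mathbf{X}$ has a finite subfamily whose union is $\mathbf{X}$.
   Context: A topological space is Noetherian if every strictly ascending chain of open sets is finite. A quasi-metric on $X$ is a function $d:X\times X\to[0,\infty)$ with $x=y\Leftrightarrow d(x,y)=d(y,x)=0$ and $d(x,z)\le d(x,y)+d(y,z)$; it induces the topology with basis $\{y\mid d(x,y)<2^{-k}\}$ ($x\in X$, $k\in\mathbb{N}$). It is Smyth-complete if every sequence $(x_n)$ such that for every $\varepsilon>0$ there is $n_0$ with $d(x_n,x_m)<\varepsilon$ for all $m\ge n\ge n_0$ converges with respect to the metric $\max(d(x,y),d(y,x))$. A topological space is quasi-Polish if it is countably based and its topology is induced by a Smyth-complete quasi-metric. (Equivalently, by known results: it is homeomorphic to a $\boldsymbol{\Pi}^0_2$-subspace of $\mathcal{P}(\omega)$ with the Scott topology.) In a (not necessarily metrizable) topological space, a set is $\boldsymbol{\Sigma}^0_2$ if it is a countable union of differences $U\setminus V$ of open sets $U,V$; $\boldsymbol{\Pi}^0_2$ if its complement is $\boldsymbol{\Sigma}^0_2$;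 and $\boldsymbol{\Delta}^0_2$ if it is both. *)

theory Defs
  imports "HOL-Analysis.Analysis"
begin

text \<open>As in \<^locale>\<open>Metric_space\<close>, nonnegativity is required on the whole type. The values of
  \<open>d\<close> off the carrier \<open>M\<close> are otherwise irrelevant, so this is only a convention.\<close>

locale Quasi_metric_space =
  fixes M :: "'a set" and d :: "'a \<Rightarrow> 'a \<Rightarrow> real"
  assumes nonneg: "0 \<le> d x y"
    and zero: "\<lbrakk>x \<in> M; y \<in> M\<rbrakk> \<Longrightarrow> x = y \<longleftrightarrow> d x y = 0 \<and> d y x = 0"
    and triangle: "\<lbrakk>x \<in> M; y \<in> M; z \<in> M\<rbrakk> \<Longrightarrow> d x z \<le> d x y + d y z"
begin

definition qball :: "'a \<Rightarrow> real \<Rightarrow> 'a set"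
  where "qball x r = {y \<in> M. d x y < r}"

definition qtopology :: "'a topology"
  where "qtopology = topology (arbitrary union_of (\<lambda>B. \<exists>x\<in>M. \<exists>k::nat. B = qball x (1 / 2 ^ k)))"

definition dsym :: "'a \<Rightarrow> 'a \<Rightarrow> real"
  where "dsym x y = max (d x y) (d y x)"

sublocale sym: Metric_space M dsym
proof
  show "0 \<le> dsym x y" for x y
    using nonneg[of x y] by (simp add: dsym_def)
  show "dsym x y = dsym y x" for x y
    by (simp add: dsym_def max.commute)
  show "dsym x y = 0 \<longleftrightarrow> x = y" if "x \<in> M" "y \<in> M" for x y
    using zero[OF that] nonneg[of x y] nonneg[of y x] unfolding dsym_def by (smt (verit))
  show "dsym x z \<le> dsym x y + dsym y z" if "x \<in> M" "y \<in> M" "z \<in> M" for x y z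
    using triangle[of x y z] triangle[of z y x] that unfolding dsym_def by (smt (verit))
qed

definition forward_Cauchy :: "(nat \<Rightarrow> 'a) \<Rightarrow> bool"
  where "forward_Cauchy \<sigma> \<longleftrightarrow> range \<sigma> \<subseteq> M \<and>
    (\<forall>\<epsilon>>0. \<exists>n0. \<forall>n m. n0 \<le> n \<and> n \<le> m \<longrightarrow> d (\<sigma> n) (\<sigma> m) < \<epsilon>)"

definition Smyth_complete :: bool
  where "Smyth_complete \<longleftrightarrow>
    (\<forall>\<sigma>. forward_Cauchy \<sigma> \<longrightarrow> (\<exists>l. limitin sym.mtopology \<sigma> l sequentially))"

lemma centre_in_qball: "x \<in> M \<Longrightarrow> 0 < r \<Longrightarrow> x \<in> qball x r"
  using zero[of x x] by (simp add: qball_def)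

lemma qball_shrink:
  assumes "x \<in> M" "z \<in> qball x r"
  shows "\<exists>k::nat. qball z (1 / 2 ^ k) \<subseteq> qball x r"
proof -
  have z: "z \<in> M" "0 < r - d x z" using assms by (auto simp: qball_def)
  then obtain k :: nat where k: "(1 / 2) ^ k < r - d x z"
    using real_arch_pow_inv[of "r - d x z" "1 / 2"] by auto
  have "y \<in> qball x r" if "y \<in> qball z (1 / 2 ^ k)" for y
    using that k triangle[OF assms(1) z(1), of y] by (auto simp: qball_def power_one_over)
  then show ?thesis by blast
qed

lemma istopology_qball_base:
  "istopology (arbitrary union_of (\<lambda>B. \<exists>x\<in>M. \<exists>k::nat. B = qball x (1 / 2 ^ k)))"
  (is "istopology (arbitrary union_of ?B)")
proof (rule istopology_base_alt[THEN iffD2], intro allI impI)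
  fix S T assume ST: "(arbitrary union_of ?B) S \<and> (arbitrary union_of ?B) T"
  have nbhd: "z \<in> M \<and> (\<exists>k::nat. qball z (1 / 2 ^ k) \<subseteq> W)"
    if W: "(arbitrary union_of ?B) W" "z \<in> W" for W z
  proof -
    obtain x and k :: nat where "x \<in> M" "z \<in> qball x (1 / 2 ^ k)" "qball x (1 / 2 ^ k) \<subseteq> W"
      using W unfolding arbitrary_union_of_alt by blast
    then show ?thesis
      using qball_shrink[of x z "1 / 2 ^ k"] by (auto simp: qball_def)
  qed
  show "(arbitrary union_of ?B) (S \<inter> T)"
    unfolding arbitrary_union_of_alt
  proof
    fix z assume "z \<in> S \<inter> T"
    then obtain j k :: nat where z: "z \<in> M"
        and jk: "qball z (1 / 2 ^ j) \<subseteq> S" "qball z (1 / 2 ^ k) \<subseteq> T"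
      using ST nbhd by (meson IntE)
    have "(1::real) / 2 ^ max j k \<le> 1 / 2 ^ j" "(1::real) / 2 ^ max j k \<le> 1 / 2 ^ k"
      by (auto intro!: divide_left_mono)
    then have "qball z (1 / 2 ^ max j k) \<subseteq> S \<inter> T"
      using jk by (force simp: qball_def)
    then show "\<exists>U. ?B U \<and> z \<in> U \<and> U \<subseteq> S \<inter> T"
      using z centre_in_qball[OF z, of "1 / 2 ^ max j k"]
      by (intro exI[of _ "qball z (1 / 2 ^ max j k)"]) auto
  qed
qed

lemma openin_qtopology:
  "openin qtopology = arbitrary union_of (\<lambda>B. \<exists>x\<in>M. \<exists>k::nat. B = qball x (1 / 2 ^ k))"
  unfolding qtopology_def by (rule topology_inverse'[OF istopology_qball_base])

lemma topspace_qtopology: "topspace qtopology = M"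
proof
  show "topspace qtopology \<subseteq> M"
    unfolding topspace_def openin_qtopology union_of_def qball_def by blast
  show "M \<subseteq> topspace qtopology"
  proof
    fix x assume x: "x \<in> M"
    have "openin qtopology (qball x (1 / 2 ^ 0))"
      unfolding openin_qtopology using x by (intro arbitrary_union_of_inc) blast
    then show "x \<in> topspace qtopology"
      using centre_in_qball[OF x, of "1 / 2 ^ 0"] openin_subset by fastforce
  qed
qed

end

definition quasi_Polish :: "'a topology \<Rightarrow> bool"
  where "quasi_Polish X \<longleftrightarrow> second_countable X \<and>
    (\<exists>d. Quasi_metric_space (topspace X) d \<and>
         Quasi_metric_space.Smyth_complete (topspace X) d \<and>
         X = Quasi_metric_space.qtopology (topspace X) d)"

text \<open>For sets, \<^const>\<open>strict_mono\<close> is with respect to strict inclusion.\<close>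

definition Noetherian_space :: "'a topology \<Rightarrow> bool"
  where "Noetherian_space X \<longleftrightarrow>
    \<not> (\<exists>U :: nat \<Rightarrow> 'a set. (\<forall>n. openin X (U n)) \<and> strict_mono U)"

text \<open>Differences of open sets replace closed sets here, since in a non-metrizable space an open
  set need not be \<^const>\<open>fsigma_in\<close>.\<close>

definition Sigma02_in :: "'a topology \<Rightarrow> 'a set \<Rightarrow> bool"
  where "Sigma02_in X =
    countable union_of (\<lambda>D. \<exists>U V. openin X U \<and> openin X V \<and> D = U - V)"

definition Pi02_in :: "'a topology \<Rightarrow> 'a set \<Rightarrow> bool"
  where "Pi02_in X A \<longleftrightarrow> A \<subseteq> topspace X \<and> Sigma02_in X (topspace X - A)"

definition Delta02_in :: "'a topology \<Rightarrow> 'a set \<Rightarrow> bool"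
  where "Delta02_in X A \<longleftrightarrow> Sigma02_in X A \<and> Pi02_in X A"

definition covers_have_finite_subcovers :: "('a set \<Rightarrow> bool) \<Rightarrow> 'a topology \<Rightarrow> bool"
  where "covers_have_finite_subcovers P X \<longleftrightarrow>
    (\<forall>\<U>. (\<forall>A\<in>\<U>. P A) \<and> \<Union>\<U> = topspace X \<longrightarrow>
      (\<exists>\<F>. finite \<F> \<and> \<F> \<subseteq> \<U> \<and> \<Union>\<F> = topspace X))"

end

theory Submission
  imports Defs
begin

text \<open>A finite subcover of a \<open>\<Sigma>\<^sup>0\<^sub>2\<close>-cover is found by Noetherian induction on the open set \<open>W\<close>
  that may be left uncovered. If the complement of \<open>W\<close> is reducible, it is the union of two smaller
  closed sets. Otherwise it has a generic point \<open>x\<close>, because quasi-Polish spaces are sober: a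
  forward Cauchy sequence visiting all basic open sets not contained in \<open>W\<close> converges to such a
  point. If \<open>x \<in> U - V\<close>, with \<open>U - V\<close> inside a member of the cover, then \<open>V \<subseteq> W\<close> by genericity, so
  that this member covers \<open>U - W\<close>, and \<open>W \<union> U\<close> is strictly larger than \<open>W\<close>. Conversely, a strictly
  ascending sequence of open sets yields a partition into infinitely many nonempty
  \<open>\<Delta>\<^sup>0\<^sub>2\<close>-sets.\<close>

section \<open>Balls, forward Cauchy sequences and generic points in quasi-metric spaces\<close>

context Quasi_metric_space
begin

lemma openin_qtopologyD:
  assumes "openin qtopology W" "z \<in> W"
  shows "\<exists>k::nat. qball z (1 / 2 ^ k) \<subseteq> W"
proof -
  obtain x and k :: nat where "x \<in> M" "z \<in> qball x (1 / 2 ^ k)" "qball x (1 / 2 ^ k) \<subseteq> W"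
    using assms unfolding openin_qtopology arbitrary_union_of_alt by blast
  then show ?thesis
    using qball_shrink[of x z "1 / 2 ^ k"] by blast
qed

lemma openin_qball:
  assumes "x \<in> M"
  shows "openin qtopology (qball x r)"
  unfolding openin_qtopology arbitrary_union_of_alt
proof
  fix z assume z: "z \<in> qball x r"
  then have "z \<in> M" by (simp add: qball_def)
  moreover obtain k :: nat where "qball z (1 / 2 ^ k) \<subseteq> qball x r"
    using qball_shrink[OF assms z] by blast
  ultimately show "\<exists>U. (\<exists>x\<in>M. \<exists>k::nat. U = qball x (1 / 2 ^ k)) \<and> z \<in> U \<and> U \<subseteq> qball x r"
    using centre_in_qball[of z "1 / 2 ^ k"] by (intro exI[of _ "qball z (1 / 2 ^ k)"]) auto
qed

text \<open>Halving radii make the step bounds summable, so the centres are forward Cauchy. This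
  drives the recursive construction of a point lying in prescribed open sets.\<close>

lemma Smyth_complete_nested_limit:
  fixes x :: "nat \<Rightarrow> 'a" and r :: "nat \<Rightarrow> real"
  assumes "Smyth_complete" and M: "\<And>n. x n \<in> M" and pos: "\<And>n. 0 < r n"
    and half: "\<And>n. r (Suc n) \<le> r n / 2" and step: "\<And>n. d (x n) (x (Suc n)) < r n / 2"
  shows "\<exists>l. limitin sym.mtopology x l sequentially \<and> (\<forall>n. l \<in> qball (x n) (r n))"
proof -
  \<comment> \<open>Subtracting \<open>r m\<close> makes the bound telescope: each step costs less
    than \<open>r m / 2\<close>, which is at most \<open>r m - r (Suc m)\<close>.\<close>
  have close: "d (x n) (x m) \<le> r n - r m" if "n \<le> m" for n m
    using that
  proof (induction m rule: dec_induct)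
    case base
    then show ?case using zero[OF M M, of n n] by simp
  next
    case (step m)
    then show ?case
      using triangle[OF M[of n] M[of m] M[of "Suc m"]] half[of m] assms(5)[of m] by linarith
  qed
  have geom: "r n \<le> r 0 * (1 / 2) ^ n" for n
  proof (induction n)
    case (Suc n)
    then show ?case using half[of n] by simp
  qed simp
  have lim: "(\<lambda>n. r 0 * (1 / 2) ^ n) \<longlonglongrightarrow> 0"
    by (intro tendsto_mult_right_zero LIMSEQ_realpow_zero) auto
  have small: "\<exists>n0. \<forall>n\<ge>n0. r 0 * (1 / 2) ^ n < e" if "0 < e" for e
    using order_tendstoD(2)[OF lim that] by (simp add: eventually_sequentially)
  have "forward_Cauchy x"
    unfolding forward_Cauchy_def
  proof (intro conjI allI impI)
    show "range x \<subseteq> M" using M by blast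
    fix e :: real assume "0 < e"
    then obtain n0 where n0: "\<And>n. n0 \<le> n \<Longrightarrow> r 0 * (1 / 2) ^ n < e" using small by blast
    have "d (x n) (x m) < e" if "n0 \<le> n" "n \<le> m" for n m
      using close[OF that(2)] pos[of m] geom[of n] n0[OF that(1)] by linarith
    then show "\<exists>n0. \<forall>n m. n0 \<le> n \<and> n \<le> m \<longrightarrow> d (x n) (x m) < e" by blast
  qed
  then obtain l where l: "limitin sym.mtopology x l sequentially"
    using assms(1) unfolding Smyth_complete_def by blast
  then have lM: "l \<in> M"
    using limitin_topspace[OF l] by simp
  have le: "d (x n) l \<le> r n" for n
  proof (rule field_le_epsilon)
    fix e :: real assume "0 < e"
    then obtain m0 where m0: "\<And>m. m0 \<le> m \<Longrightarrow> dsym (x m) l < e"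
      using l unfolding sym.limit_metric_sequentially by blast
    define m where "m = max m0 n"
    have "d (x m) l < e" using m0[of m] by (simp add: m_def dsym_def)
    moreover have "d (x n) (x m) \<le> r n - r m" by (rule close) (simp add: m_def)
    ultimately show "d (x n) l \<le> r n + e"
      using triangle[OF M[of n] M[of m] lM] pos[of m] by linarith
  qed
  \<comment> \<open>Strictness comes from the first step: \<open>d (x n) l\<close> is less than
    \<open>r n / 2 + r (Suc n)\<close>, hence than \<open>r n\<close>.\<close>
  have "d (x n) l < r n" for n
    using triangle[OF M[of n] M[of "Suc n"] lM] le[of "Suc n"] half[of n] step[of n] by linarith
  then show ?thesis using l lM by (auto simp: qball_def)
qed

text \<open>Sobriety: \<open>W\<close> is the complement of an irreducible closed set and \<open>l\<close> is its generic point.\<close>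

lemma Smyth_complete_generic_point:
  assumes "Smyth_complete" and "second_countable qtopology"
    and W: "openin qtopology W" "W \<noteq> M"
    and irred: "\<And>U V. \<lbrakk>openin qtopology U; openin qtopology V; U \<inter> V \<subseteq> W\<rbrakk> \<Longrightarrow> U \<subseteq> W \<or> V \<subseteq> W"
  shows "\<exists>l \<in> M - W. \<forall>U. openin qtopology U \<longrightarrow> U \<subseteq> W \<or> l \<in> U"
proof -
  obtain \<B> where \<B>: "countable \<B>" "\<And>V. V \<in> \<B> \<Longrightarrow> openin qtopology V"
      "\<And>U x. openin qtopology U \<Longrightarrow> x \<in> U \<Longrightarrow> \<exists>V \<in> \<B>. x \<in> V \<and> V \<subseteq> U"
    using assms(2) unfolding second_countable_def by metis
  have WM: "W \<subseteq> M" using openin_subset[OF W(1)] by (simp add: topspace_qtopology)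
  define \<C> where "\<C> = {V \<in> \<B>. \<not> V \<subseteq> W}"
  have meets: "\<exists>V\<in>\<C>. V \<subseteq> U" if "openin qtopology U" "\<not> U \<subseteq> W" for U
    using \<B>(3)[OF that(1)] that(2) unfolding \<C>_def by blast
  have "\<not> M \<subseteq> W" using W(2) WM by blast
  then have "\<C> \<noteq> {}"
    using meets[of M] openin_topspace[of qtopology] by (auto simp: topspace_qtopology)
  then have B_range: "range (from_nat_into \<C>) = \<C>"
    using \<B>(1) by (intro range_from_nat_into) (auto simp: \<C>_def)
  \<comment> \<open>An enumeration of \<open>\<C>\<close>, possibly with repetitions. By
    \<open>meets\<close>, a point of all \<open>B n\<close> lies in every open set not contained in
    \<open>W\<close>.\<close>
  define B where "B = from_nat_into \<C>"
  have B: "openin qtopology (B n)" "\<not> B n \<subseteq> W" for n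
  proof -
    have "B n \<in> \<C>" using B_range unfolding B_def by blast
    then show "openin qtopology (B n)" "\<not> B n \<subseteq> W" using \<B>(2) by (auto simp: \<C>_def)
  qed
  \<comment> \<open>One stage of the recursion on pairs (centre, radius): the new centre stays
    outside \<open>W\<close> and the new ball fits into \<open>B n\<close>.\<close>
  have ex: "\<exists>q. (fst q \<in> M - W \<and> 0 < snd q) \<and>
      (snd q \<le> snd p / 2 \<and> d (fst p) (fst q) < snd p / 2 \<and> qball (fst q) (snd q) \<subseteq> B n)"
    if p: "fst p \<in> M - W \<and> 0 < snd p" for p n
  proof -
    let ?Q = "qball (fst p) (snd p / 2)"
    have Q: "openin qtopology ?Q" "fst p \<in> ?Q"
      using p centre_in_qball openin_qball by auto
    \<comment> \<open>Neither \<open>?Q\<close> nor \<open>B n\<close> is contained in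
      \<open>W\<close>, so by irreducibility their intersection is not either.\<close>
    then obtain y where y: "y \<in> ?Q" "y \<in> B n" "y \<notin> W"
      using irred[OF Q(1) B(1)[of n]] B(2)[of n] p by blast
    obtain k :: nat where k: "qball y (1 / 2 ^ k) \<subseteq> B n"
      using openin_qtopologyD[OF B(1) y(2)] by blast
    let ?r = "min (1 / 2 ^ k) (snd p / 2)"
    have "qball y ?r \<subseteq> B n" using k by (auto simp: qball_def)
    then show ?thesis
      using y p by (intro exI[of _ "(y, ?r)"]) (auto simp: qball_def)
  qed
  obtain x0 where "x0 \<in> M - W" using \<open>\<not> M \<subseteq> W\<close> by blast
  then have "\<exists>p::'a \<times> real. fst p \<in> M - W \<and> 0 < snd p"
    by (intro exI[of _ "(x0, 1)"]) auto
  then have "\<exists>f. \<forall>n. (fst (f n) \<in> M - W \<and> 0 < snd (f n)) \<and>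
      (snd (f (Suc n)) \<le> snd (f n) / 2 \<and> d (fst (f n)) (fst (f (Suc n))) < snd (f n) / 2 \<and>
        qball (fst (f (Suc n))) (snd (f (Suc n))) \<subseteq> B n)"
    using ex
    by (rule dependent_nat_choice[where P = "\<lambda>n p. fst p \<in> M - W \<and> 0 < snd p"
        and Q = "\<lambda>n p q. snd q \<le> snd p / 2 \<and> d (fst p) (fst q) < snd p / 2 \<and>
          qball (fst q) (snd q) \<subseteq> B n"])
  then obtain f where "\<forall>n. (fst (f n) \<in> M - W \<and> 0 < snd (f n)) \<and>
      (snd (f (Suc n)) \<le> snd (f n) / 2 \<and> d (fst (f n)) (fst (f (Suc n))) < snd (f n) / 2 \<and>
        qball (fst (f (Suc n))) (snd (f (Suc n))) \<subseteq> B n)" ..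
  then have f: "\<And>n. fst (f n) \<in> M - W \<and> 0 < snd (f n)"
    and fS: "\<And>n. snd (f (Suc n)) \<le> snd (f n) / 2 \<and> d (fst (f n)) (fst (f (Suc n))) < snd (f n) / 2 \<and>
        qball (fst (f (Suc n))) (snd (f (Suc n))) \<subseteq> B n"
    by simp_all
  obtain l where l: "limitin sym.mtopology (\<lambda>n. fst (f n)) l sequentially"
      and ball: "\<And>n. l \<in> qball (fst (f n)) (snd (f n))"
    using Smyth_complete_nested_limit[OF assms(1), of "\<lambda>n. fst (f n)" "\<lambda>n. snd (f n)"] f fS
    by blast
  have "l \<in> M" using ball[of 0] by (simp add: qball_def)
  \<comment> \<open>Convergence in \<open>dsym\<close> also makes the distances from
    \<open>l\<close> to the centres small. A ball around \<open>l\<close> inside \<open>W\<close>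
    would thus contain a centre, yet all centres avoid \<open>W\<close>.\<close>
  moreover have "l \<notin> W"
  proof
    assume "l \<in> W"
    then obtain k :: nat where k: "qball l (1 / 2 ^ k) \<subseteq> W"
      using openin_qtopologyD[OF W(1)] by blast
    have "(0::real) < 1 / 2 ^ k" by simp
    then obtain n where "dsym (fst (f n)) l < 1 / 2 ^ k"
      using l unfolding sym.limit_metric_sequentially by blast
    then have "fst (f n) \<in> qball l (1 / 2 ^ k)"
      using f[of n] by (simp add: qball_def dsym_def)
    then show False using k f[of n] by blast
  qed
  moreover have "l \<in> U" if U: "openin qtopology U" "\<not> U \<subseteq> W" for U
  proof -
    obtain V where "V \<in> \<C>" "V \<subseteq> U" using meets[OF U] by blast
    then obtain n where "B n \<subseteq> U" using B_range unfolding B_def by (metis imageE)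
    \<comment> \<open>The shift by one occurs because stage \<open>n\<close> places ball number
      \<open>Suc n\<close> inside \<open>B n\<close>.\<close>
    then show ?thesis using ball[of "Suc n"] fS[of n] by blast
  qed
  ultimately show ?thesis by blast
qed

end

lemma quasi_Polish_generic_point:
  assumes "quasi_Polish X" "openin X W" "W \<noteq> topspace X"
    and "\<And>U V. \<lbrakk>openin X U; openin X V; U \<inter> V \<subseteq> W\<rbrakk> \<Longrightarrow> U \<subseteq> W \<or> V \<subseteq> W"
  shows "\<exists>l \<in> topspace X - W. \<forall>U. openin X U \<longrightarrow> U \<subseteq> W \<or> l \<in> U"
proof -
  obtain d where d: "Quasi_metric_space (topspace X) d"
      "Quasi_metric_space.Smyth_complete (topspace X) d"
      and X: "X = Quasi_metric_space.qtopology (topspace X) d" and sc: "second_countable X"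
    using assms(1) unfolding quasi_Polish_def by blast
  show ?thesis
    using Quasi_metric_space.Smyth_complete_generic_point[OF d, of W, folded X, OF sc assms(2-4)] .
qed

section \<open>Noetherian induction and covers by
  \<open>\<Sigma>\<^sup>0\<^sub>2\<close>-sets\<close>

text \<open>The order is reversed: larger open sets count as smaller, so an infinite descent is a
  strictly ascending sequence of open sets.\<close>

lemma Noetherian_space_imp_wf:
  assumes "Noetherian_space X"
  shows "wf {(U, V). openin X U \<and> openin X V \<and> V \<subset> U}"
  unfolding wf_iff_no_infinite_down_chain
proof
  assume "\<exists>f. \<forall>i. (f (Suc i), f i) \<in> {(U, V). openin X U \<and> openin X V \<and> V \<subset> U}"
  then obtain f where "\<forall>i. openin X (f i) \<and> f i \<subset> f (Suc i)" by simp metis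
  then have "(\<forall>i. openin X (f i)) \<and> strict_mono f" by (simp add: strict_mono_Suc_iff)
  then show False
    using assms unfolding Noetherian_space_def by metis
qed

lemma Sigma02_inD:
  assumes "Sigma02_in X A" "x \<in> A"
  shows "\<exists>U V. openin X U \<and> openin X V \<and> x \<in> U - V \<and> U - V \<subseteq> A"
  using assms unfolding Sigma02_in_def union_of_def by blast

lemma Sigma02_in_diff: "\<lbrakk>openin X U; openin X V\<rbrakk> \<Longrightarrow> Sigma02_in X (U - V)"
  unfolding Sigma02_in_def by (intro countable_union_of_inc) blast

text \<open>The complement of a difference is a union of two differences, one closed and one
  open.\<close>

lemma Delta02_in_diff:
  assumes "openin X U" "openin X V"
  shows "Delta02_in X (U - V)"
proof -
  have "topspace X - (U - V) = (topspace X - U) \<union> (V - {})"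
    using openin_subset[OF assms(2)] by blast
  moreover have "Sigma02_in X ((topspace X - U) \<union> (V - {}))"
    using Sigma02_in_diff[OF openin_topspace assms(1)] Sigma02_in_diff[OF assms(2) openin_empty]
    unfolding Sigma02_in_def by (rule countable_union_of_Un)
  ultimately show ?thesis
    using assms openin_subset[OF assms(1)] Sigma02_in_diff
    unfolding Delta02_in_def Pi02_in_def by auto
qed

lemma Noetherian_quasi_Polish_Sigma02_finite_subcover:
  assumes "quasi_Polish X" "Noetherian_space X"
    and \<U>: "\<And>A. A \<in> \<U> \<Longrightarrow> Sigma02_in X A" "\<Union>\<U> = topspace X" and "openin X W"
  shows "\<exists>\<F>. finite \<F> \<and> \<F> \<subseteq> \<U> \<and> topspace X \<subseteq> W \<union> \<Union>\<F>"
  using Noetherian_space_imp_wf[OF assms(2)] \<open>openin X W\<close>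
proof (induction W rule: wf_induct_rule)
  case (less W)
  have IH: "\<exists>\<F>. finite \<F> \<and> \<F> \<subseteq> \<U> \<and> topspace X \<subseteq> (W \<union> U) \<union> \<Union>\<F>"
    if "openin X U" "\<not> U \<subseteq> W" for U
    using less.IH[of "W \<union> U"] that less.prems by blast
  consider "W = topspace X"
    | U V where "openin X U" "openin X V" "U \<inter> V \<subseteq> W" "\<not> U \<subseteq> W" "\<not> V \<subseteq> W"
    | l where "l \<in> topspace X - W" "\<And>U. openin X U \<Longrightarrow> U \<subseteq> W \<or> l \<in> U"
    using quasi_Polish_generic_point[OF assms(1) less.prems] by metis
  then show ?case
  proof cases
    case 1
    then show ?thesis by (intro exI[of _ "{}"]) auto
  next
    case 2
    \<comment> \<open>Since \<open>U \<inter> V \<subseteq> W\<close>, the sets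
      \<open>W \<union> U\<close> and \<open>W \<union> V\<close> meet exactly in \<open>W\<close>,
      so both subcovers together cover everything outside \<open>W\<close>.\<close>
    obtain \<F> \<G> where "finite \<F>" "\<F> \<subseteq> \<U>" "topspace X \<subseteq> (W \<union> U) \<union> \<Union>\<F>"
        and "finite \<G>" "\<G> \<subseteq> \<U>" "topspace X \<subseteq> (W \<union> V) \<union> \<Union>\<G>"
      using IH[OF 2(1,4)] IH[OF 2(2,5)] by metis
    then show ?thesis using 2(3) by (intro exI[of _ "\<F> \<union> \<G>"]) blast
  next
    case 3
    then obtain A where A: "A \<in> \<U>" "l \<in> A" using \<U>(2) by blast
    then obtain U V where UV: "openin X U" "openin X V" "l \<in> U - V" "U - V \<subseteq> A"
      using Sigma02_inD[OF \<U>(1)] by metis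
    \<comment> \<open>The generic point \<open>l\<close> misses \<open>V\<close>. It lies in
      \<open>U\<close> but not in \<open>W\<close>, so the induction hypothesis applies to
      \<open>W \<union> U\<close>.\<close>
    have "V \<subseteq> W" using 3(2)[OF UV(2)] UV(3) by blast
    moreover obtain \<F> where "finite \<F>" "\<F> \<subseteq> \<U>" "topspace X \<subseteq> (W \<union> U) \<union> \<Union>\<F>"
      using IH[OF UV(1)] UV(3) 3(1) by blast
    ultimately show ?thesis
      using A(1) UV(4) by (intro exI[of _ "insert A \<F>"]) auto
  qed
qed

lemma Sigma02_finite_subcovers_if_Noetherian:
  assumes "quasi_Polish X" "Noetherian_space X"
  shows "covers_have_finite_subcovers (Sigma02_in X) X"
  unfolding covers_have_finite_subcovers_def
proof (intro allI impI)
  fix \<U> assume "(\<forall>A\<in>\<U>. Sigma02_in X A) \<and> \<Union>\<U> = topspace X"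
  then show "\<exists>\<F>. finite \<F> \<and> \<F> \<subseteq> \<U> \<and> \<Union>\<F> = topspace X"
    using Noetherian_quasi_Polish_Sigma02_finite_subcover[OF assms, of \<U> "{}"]
    by (metis Sup_subset_mono openin_empty subset_antisym sup_bot_left)
qed

section \<open>Ascending sequences and covers by
  \<open>\<Delta>\<^sup>0\<^sub>2\<close>-sets\<close>

lemma Noetherian_if_Delta02_finite_subcovers:
  assumes "covers_have_finite_subcovers (Delta02_in X) X"
  shows "Noetherian_space X"
  unfolding Noetherian_space_def
proof
  assume "\<exists>U :: nat \<Rightarrow> 'a set. (\<forall>n. openin X (U n)) \<and> strict_mono U"
  then obtain U :: "nat \<Rightarrow> 'a set" where U: "\<And>n. openin X (U n)" and mono: "strict_mono U"
    by blast
  have sub: "U m \<subseteq> U n" if "m \<le> n" for m n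
    using mono that by (simp add: strict_mono_less_eq)
  define D where "D n = U (Suc n) - U n" for n
  \<comment> \<open>The successive layers, the bottom set and the remainder. Writing
    \<open>U 0 - {}\<close> gives every member the form of a difference of open sets.\<close>
  define \<U> where "\<U> = insert (U 0 - {}) (insert (topspace X - (\<Union>n. U n)) (range D))"
  have "Delta02_in X A" if "A \<in> \<U>" for A
    using that U unfolding \<U>_def D_def
    by (auto intro!: Delta02_in_diff openin_Union simp del: Diff_empty)
  moreover have "\<Union>\<U> = topspace X"
  proof
    show "\<Union>\<U> \<subseteq> topspace X"
      using openin_subset[OF U] unfolding \<U>_def D_def by blast
    have "U n \<subseteq> U 0 \<union> \<Union>(range D)" for n
    proof (induction n)
      case (Suc n)
      have "U (Suc n) \<subseteq> U n \<union> D n" unfolding D_def by blast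
      then show ?case using Suc by blast
    qed blast
    moreover have "\<Union>\<U> = U 0 \<union> \<Union>(range D) \<union> (topspace X - (\<Union>n. U n))"
      unfolding \<U>_def by (simp add: Un_commute Un_left_commute)
    ultimately have "U n \<subseteq> \<Union>\<U>" for n
      by (metis le_supI1)
    then have "(\<Union>n. U n) \<subseteq> \<Union>\<U>" by (intro UN_least)
    moreover have "topspace X - (\<Union>n. U n) \<subseteq> \<Union>\<U>"
      by (rule Union_upper) (simp add: \<U>_def)
    ultimately have "topspace X \<subseteq> (\<Union>n. U n) \<union> \<Union>\<U>" "(\<Union>n. U n) \<union> \<Union>\<U> = \<Union>\<U>"
      by (simp_all only: Diff_subset_conv Un_absorb1)
    then show "topspace X \<subseteq> \<Union>\<U>" by (simp only:)
  qed
  ultimately obtain \<F> where \<F>: "finite \<F>" "\<F> \<subseteq> \<U>" "\<Union>\<F> = topspace X"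
    using assms unfolding covers_have_finite_subcovers_def by metis
  have D_nonempty: "\<exists>x. x \<in> D n" for n
    using mono unfolding strict_mono_Suc_iff D_def by blast
  \<comment> \<open>No other member of \<open>\<U>\<close> meets \<open>D n\<close>. As
    \<open>D n\<close> is nonempty, every subcover must contain it.\<close>
  have D_unique: "A = D n" if "A \<in> \<U>" "x \<in> A" "x \<in> D n" for A x n
  proof -
    have "m = n" if "x \<in> D m" for m
      using that \<open>x \<in> D n\<close> sub[of "Suc m" n] sub[of "Suc n" m] unfolding D_def
      by (cases m n rule: linorder_cases) auto
    moreover have "x \<notin> U 0" "x \<in> (\<Union>n. U n)"
      using \<open>x \<in> D n\<close> sub[of 0 n] unfolding D_def by auto
    ultimately show ?thesis using that(1,2) unfolding \<U>_def by auto
  qed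
  have "D n \<in> \<F>" for n
  proof -
    obtain x where x: "x \<in> D n" using D_nonempty by blast
    then have "x \<in> \<Union>\<F>" using \<F>(3) openin_subset[OF U] unfolding D_def by blast
    then show ?thesis using D_unique x \<F>(2) by blast
  qed
  \<comment> \<open>Nonempty disjoint layers are distinct, so the finite \<open>\<F>\<close> would
    contain infinitely many sets.\<close>
  moreover have "inj D"
  proof
    fix m n assume "D m = D n"
    obtain x where "x \<in> D m" using D_nonempty by blast
    with \<open>D m = D n\<close> show "m = n"
      using sub[of "Suc m" n] sub[of "Suc n" m] unfolding D_def
      by (cases m n rule: linorder_cases) auto
  qed
  ultimately show False
    using \<F>(1) finite_subset[of "range D" \<F>] finite_imageD[of D UNIV] by auto
qed

theorem theorem12:
  fixes X :: "'a topology"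
  assumes "quasi_Polish X"
  shows "(Noetherian_space X \<longleftrightarrow> covers_have_finite_subcovers (Delta02_in X) X) \<and>
    (covers_have_finite_subcovers (Delta02_in X) X \<longleftrightarrow>
      covers_have_finite_subcovers (Sigma02_in X) X)"
proof -
  have "covers_have_finite_subcovers (Delta02_in X) X"
    if "covers_have_finite_subcovers (Sigma02_in X) X"
    using that unfolding covers_have_finite_subcovers_def Delta02_in_def by simp
  then show ?thesis
    using Sigma02_finite_subcovers_if_Noetherian[OF assms] Noetherian_if_Delta02_finite_subcovers
    by blast
qed

end
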